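(* For every integer $m\ge1$ and every $0\le\alpha\le1$, the matrix $B_m(\alpha)$ is an extreme point of $\omega_m^{m-1+\alpha}$.
   Context: $\omega_m$ is the set of $m\times m$ nonnegative real matrices with all row and column sums at most $1$; $\omega_m^t$ is the set of $A\in\omega_m$ whose entries sum to $t$. $B_m(\alpha)$ is the $m\times m$ matrix with every diagonal entry equal to $\alpha$, every entry in position $(i+1,i)$ ($1\le i\le m-1$) equal to $1-\alpha$, and all other entries $0$; $B_1(\alpha)=(\alpha)$. An extreme point of a convex set $C$ is a point of $C$ that is not of the form $\lambda y+(1-\lambda)z$ with $y,z\in C$, $y\ne z$, $0<\lambda<1$. *)

theory Defs
  imports Complex_Main "Jordan_Normal_Form.Matrix"
begin

text \<open>Matrix indices start at 0, so position (i, j) here is position (i + 1, j + 1)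
  in the usual numbering.\<close>

definition doubly_substochastic :: "nat \<Rightarrow> real mat set" where
  "doubly_substochastic m = {A \<in> carrier_mat m m.
     (\<forall>i<m. \<forall>j<m. 0 \<le> A $$ (i, j)) \<and>
     (\<forall>i<m. (\<Sum>j<m. A $$ (i, j)) \<le> 1) \<and>
     (\<forall>j<m. (\<Sum>i<m. A $$ (i, j)) \<le> 1)}"

definition doubly_substochastic_sum :: "nat \<Rightarrow> real \<Rightarrow> real mat set" where
  "doubly_substochastic_sum m t =
     {A \<in> doubly_substochastic m. (\<Sum>i<m. \<Sum>j<m. A $$ (i, j)) = t}"

definition B_mat :: "nat \<Rightarrow> real \<Rightarrow> real mat" where
  "B_mat m \<alpha> = mat m m (\<lambda>(i, j). if i = j then \<alpha> else if i = j + 1 then 1 - \<alpha> else 0)"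

text \<open>The type of matrices of varying dimension is not a real vector space, so
  the constant \<open>extreme_point_of\<close> of the analysis library does not apply to it.\<close>

definition extreme_point_mat :: "real mat \<Rightarrow> real mat set \<Rightarrow> bool" where
  "extreme_point_mat X C \<longleftrightarrow> X \<in> C \<and>
     \<not> (\<exists>Y\<in>C. \<exists>Z\<in>C. \<exists>c::real. Y \<noteq> Z \<and> 0 < c \<and> c < 1 \<and>
          X = c \<cdot>\<^sub>m Y + (1 - c) \<cdot>\<^sub>m Z)"

end

theory Submission
  imports Defs
begin

text \<open>
  If B is a proper convex combination of Y and Z, then Y and Z vanish wherever B does, and their
  row and column sums equal 1 wherever those of B do. So Y and Z are lower bidiagonal, and comparing
  the sum of column j with the sum of row j + 1, which share the subdiagonal entry, shows that the
  diagonal is constant. Hence Y and Z are of the form B(\<open>\<beta>\<close>), and the total entry sum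
  m - 1 + \<open>\<beta>\<close> determines \<open>\<beta>\<close>.
\<close>

text \<open>Both summands are nonnegative, so neither can compensate for the other. This is applied
  to each entry of \<open>Y\<close> and \<open>Z\<close> off the two diagonals of
  \<open>B_mat\<close>.\<close>

lemma convex_combination_eq_0D:
  fixes c y z :: real
  assumes "0 < c" "c < 1" "0 \<le> y" "0 \<le> z" "c * y + (1 - c) * z = 0"
  shows "y = 0" and "z = 0"
proof -
  have "0 \<le> c * y" "0 \<le> (1 - c) * z"
    using assms by simp_all
  with assms(5) have "c * y = 0" "(1 - c) * z = 0"
    by linarith+
  with assms show "y = 0" "z = 0"
    by auto
qed

text \<open>The slacks 1 - y and 1 - z are nonnegative with convex combination 0, so the previous
  lemma applies to them.\<close>

lemma convex_combination_eq_1D: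
  fixes c y z :: real
  assumes "0 < c" "c < 1" "y \<le> 1" "z \<le> 1" "c * y + (1 - c) * z = 1"
  shows "y = 1" and "z = 1"
proof -
  have "c * (1 - y) + (1 - c) * (1 - z) = 0"
    using assms(5) by (simp add: algebra_simps)
  from convex_combination_eq_0D[OF assms(1,2) _ _ this] assms show "y = 1" "z = 1"
    by auto
qed

text \<open>In a lower bidiagonal matrix, k and k + 1 are the support of row k + 1 and also of
  column k, so one lemma serves both.\<close>

lemma sum_lessThan_two_consecutive:
  fixes f :: "nat \<Rightarrow> 'a::comm_monoid_add"
  assumes "Suc k < m" and "\<And>j. j < m \<Longrightarrow> j \<noteq> k \<Longrightarrow> j \<noteq> Suc k \<Longrightarrow> f j = 0"
  shows "(\<Sum>j<m. f j) = f k + f (Suc k)"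
proof -
  have "(\<Sum>j<m. f j) = (\<Sum>j\<in>{k, Suc k}. f j)"
    using assms by (intro sum.mono_neutral_right) auto
  then show ?thesis
    by simp
qed

text \<open>The boundary case: row 0 and the last column of \<open>B_mat\<close> contain a diagonal
  entry but no subdiagonal one.\<close>

lemma sum_lessThan_single:
  fixes f :: "nat \<Rightarrow> 'a::comm_monoid_add"
  assumes "k < m" and "\<And>j. j < m \<Longrightarrow> j \<noteq> k \<Longrightarrow> f j = 0"
  shows "(\<Sum>j<m. f j) = f k"
proof -
  have "(\<Sum>j<m. f j) = (\<Sum>j\<in>{k}. f j)"
    using assms by (intro sum.mono_neutral_right) auto
  then show ?thesis
    by simp
qed

lemma B_mat_carrier [simp]:
  "B_mat m \<alpha> \<in> carrier_mat m m" "dim_row (B_mat m \<alpha>) = m" "dim_col (B_mat m \<alpha>) = m"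
  by (simp_all add: B_mat_def)

lemma B_mat_index:
  assumes "i < m" "j < m"
  shows "B_mat m \<alpha> $$ (i, j) = (if i = j then \<alpha> else if i = Suc j then 1 - \<alpha> else 0)"
  using assms by (simp add: B_mat_def)

lemma B_mat_row_sum:
  assumes "i < m"
  shows "(\<Sum>j<m. B_mat m \<alpha> $$ (i, j)) = (if i = 0 then \<alpha> else 1)"
proof (cases i)
  case 0
  then show ?thesis
    using assms by (subst sum_lessThan_single[of 0]) (auto simp: B_mat_index)
next
  case (Suc k)
  then show ?thesis
    using assms by (subst sum_lessThan_two_consecutive[of k]) (auto simp: B_mat_index)
qed

lemma B_mat_column_sum:
  assumes "j < m"
  shows "(\<Sum>i<m. B_mat m \<alpha> $$ (i, j)) = (if Suc j = m then \<alpha> else 1)"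
proof (cases "Suc j = m")
  case True
  then show ?thesis
    using assms by (subst sum_lessThan_single[of j]) (auto simp: B_mat_index)
next
  case False
  then show ?thesis
    using assms by (subst sum_lessThan_two_consecutive[of j]) (auto simp: B_mat_index)
qed

lemma B_mat_sum:
  assumes "1 \<le> m"
  shows "(\<Sum>i<m. \<Sum>j<m. B_mat m \<alpha> $$ (i, j)) = real m - 1 + \<alpha>"
proof -
  obtain n where m: "m = Suc n"
    using assms by (cases m) auto
  have "(\<Sum>i<m. \<Sum>j<m. B_mat m \<alpha> $$ (i, j)) = (\<Sum>i<m. if i = 0 then \<alpha> else 1)"
    by (intro sum.cong) (auto simp: B_mat_row_sum)
  also have "\<dots> = real m - 1 + \<alpha>"
    \<comment> \<open>Row 0 is split off; the remaining m - 1 rows contribute 1 each.\<close>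
    unfolding m by (subst sum.lessThan_Suc_shift) simp
  finally show ?thesis .
qed

text \<open>The two bounds on \<alpha> make \<alpha> and 1 - \<alpha> nonnegative, and every row or
  column sum is \<alpha> or 1.\<close>

lemma B_mat_in_doubly_substochastic_sum:
  assumes "1 \<le> m" "0 \<le> \<alpha>" "\<alpha> \<le> 1"
  shows "B_mat m \<alpha> \<in> doubly_substochastic_sum m (real m - 1 + \<alpha>)"
  using assms B_mat_sum[of m \<alpha>]
  by (auto simp: doubly_substochastic_sum_def doubly_substochastic_def
      B_mat_row_sum B_mat_column_sum) (auto simp: B_mat_index)

text \<open>Row 0 and the last column carry no sum condition, since their sums in B(\<beta>) are
  \<beta>. This leaves one free parameter, read off at position (0, 0).\<close>

lemma bidiagonal_eq_B_mat:
  assumes Y: "Y \<in> carrier_mat m m"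
    and zero: "\<And>i j. i < m \<Longrightarrow> j < m \<Longrightarrow> i \<noteq> j \<Longrightarrow> i \<noteq> Suc j \<Longrightarrow> Y $$ (i, j) = 0"
    and row: "\<And>k. Suc k < m \<Longrightarrow> (\<Sum>j<m. Y $$ (Suc k, j)) = 1"
    and col: "\<And>k. Suc k < m \<Longrightarrow> (\<Sum>i<m. Y $$ (i, k)) = 1"
  shows "Y = B_mat m (Y $$ (0, 0))"
proof -
  have row': "Y $$ (Suc k, k) + Y $$ (Suc k, Suc k) = 1" if "Suc k < m" for k
    using row[OF that] that by (subst (asm) sum_lessThan_two_consecutive[of k]) (auto intro: zero)
  have col': "Y $$ (k, k) + Y $$ (Suc k, k) = 1" if "Suc k < m" for k
    using col[OF that] that by (subst (asm) sum_lessThan_two_consecutive[of k]) (auto intro: zero)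
  have diag: "Y $$ (k, k) = Y $$ (0, 0)" if "k < m" for k
    using that
  proof (induction k)
    case (Suc k)
    then show ?case
      using row'[of k] col'[of k] by simp
  qed simp
  have subdiag: "Y $$ (Suc k, k) = 1 - Y $$ (0, 0)" if "Suc k < m" for k
    using col'[OF that] diag[of k] that by simp
  show ?thesis
    using Y by (intro eq_matI) (auto simp: B_mat_index zero subdiag intro: diag)
qed

text \<open>The entries of B(\<beta>) sum to m - 1 + \<beta>, so prescribing the total fixes
  \<beta>. The lemma concerns a single matrix because it is applied to \<open>Y\<close> and
  \<open>Z\<close> in turn.\<close>

lemma eq_B_mat_if_sum_eq:
  assumes "1 \<le> m"
    and Y: "Y \<in> doubly_substochastic_sum m (real m - 1 + \<alpha>)"
    and zero: "\<And>i j. i < m \<Longrightarrow> j < m \<Longrightarrow> i \<noteq> j \<Longrightarrow> i \<noteq> Suc j \<Longrightarrow> Y $$ (i, j) = 0"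
    and row: "\<And>k. Suc k < m \<Longrightarrow> (\<Sum>j<m. Y $$ (Suc k, j)) = 1"
    and col: "\<And>k. Suc k < m \<Longrightarrow> (\<Sum>i<m. Y $$ (i, k)) = 1"
  shows "Y = B_mat m \<alpha>"
proof -
  have "Y \<in> carrier_mat m m" and sum: "(\<Sum>i<m. \<Sum>j<m. Y $$ (i, j)) = real m - 1 + \<alpha>"
    using Y by (auto simp: doubly_substochastic_sum_def doubly_substochastic_def)
  then have eq: "Y = B_mat m (Y $$ (0, 0))"
    by (intro bidiagonal_eq_B_mat zero row col)
  have "real m - 1 + Y $$ (0, 0) = real m - 1 + \<alpha>"
    using sum B_mat_sum[OF \<open>1 \<le> m\<close>, of "Y $$ (0, 0)"] eq by simp
  with eq show ?thesis
    by simp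
qed

theorem theorem5p3:
  fixes m :: nat and \<alpha> :: real
  assumes "1 \<le> m" and "0 \<le> \<alpha>" and "\<alpha> \<le> 1"
  shows "extreme_point_mat (B_mat m \<alpha>) (doubly_substochastic_sum m (real m - 1 + \<alpha>))"
proof -
  let ?C = "doubly_substochastic_sum m (real m - 1 + \<alpha>)"
  \<comment> \<open>Extremality in contrapositive form: every proper decomposition is
    trivial.\<close>
  have "Y = Z"
    if Y: "Y \<in> ?C" and Z: "Z \<in> ?C" and c: "0 < c" "c < 1"
      and B: "B_mat m \<alpha> = c \<cdot>\<^sub>m Y + (1 - c) \<cdot>\<^sub>m Z" for Y Z c
  proof -
    have Y': "Y \<in> carrier_mat m m" "\<And>i j. i < m \<Longrightarrow> j < m \<Longrightarrow> 0 \<le> Y $$ (i, j)"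
      "\<And>i. i < m \<Longrightarrow> (\<Sum>j<m. Y $$ (i, j)) \<le> 1" "\<And>j. j < m \<Longrightarrow> (\<Sum>i<m. Y $$ (i, j)) \<le> 1"
      using Y by (auto simp: doubly_substochastic_sum_def doubly_substochastic_def)
    have Z': "Z \<in> carrier_mat m m" "\<And>i j. i < m \<Longrightarrow> j < m \<Longrightarrow> 0 \<le> Z $$ (i, j)"
      "\<And>i. i < m \<Longrightarrow> (\<Sum>j<m. Z $$ (i, j)) \<le> 1" "\<And>j. j < m \<Longrightarrow> (\<Sum>i<m. Z $$ (i, j)) \<le> 1"
      using Z by (auto simp: doubly_substochastic_sum_def doubly_substochastic_def)
    have entry: "B_mat m \<alpha> $$ (i, j) = c * Y $$ (i, j) + (1 - c) * Z $$ (i, j)"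
      if "i < m" "j < m" for i j
      using that Y'(1) Z'(1) by (simp add: B)
    have zero: "Y $$ (i, j) = 0" "Z $$ (i, j) = 0"
      if "i < m" "j < m" "i \<noteq> j" "i \<noteq> Suc j" for i j
    proof -
      have "c * Y $$ (i, j) + (1 - c) * Z $$ (i, j) = 0"
        using entry[of i j] that by (simp add: B_mat_index)
      from convex_combination_eq_0D[OF c _ _ this] Y'(2) Z'(2) that
      show "Y $$ (i, j) = 0" "Z $$ (i, j) = 0"
        by auto
    qed
    have row: "(\<Sum>j<m. Y $$ (Suc k, j)) = 1" "(\<Sum>j<m. Z $$ (Suc k, j)) = 1" if "Suc k < m" for k
    proof -
      \<comment> \<open>Row sums are linear in the matrix, and below row 0 those of B attain the
        upper bound 1, which forces equality in both \<open>Y\<close> and \<open>Z\<close>.\<close>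
      have "(\<Sum>j<m. B_mat m \<alpha> $$ (Suc k, j))
          = c * (\<Sum>j<m. Y $$ (Suc k, j)) + (1 - c) * (\<Sum>j<m. Z $$ (Suc k, j))"
        using that by (simp add: entry sum.distrib sum_distrib_left)
      then have "c * (\<Sum>j<m. Y $$ (Suc k, j)) + (1 - c) * (\<Sum>j<m. Z $$ (Suc k, j)) = 1"
        using that by (simp add: B_mat_row_sum)
      from convex_combination_eq_1D[OF c _ _ this] Y'(3) Z'(3) that
      show "(\<Sum>j<m. Y $$ (Suc k, j)) = 1" "(\<Sum>j<m. Z $$ (Suc k, j)) = 1"
        by auto
    qed
    have col: "(\<Sum>i<m. Y $$ (i, k)) = 1" "(\<Sum>i<m. Z $$ (i, k)) = 1" if "Suc k < m" for k
    proof -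
      \<comment> \<open>The same argument for columns; \<open>Suc k < m\<close> leaves out the last
        column, whose sum is \<alpha>.\<close>
      have "(\<Sum>i<m. B_mat m \<alpha> $$ (i, k))
          = c * (\<Sum>i<m. Y $$ (i, k)) + (1 - c) * (\<Sum>i<m. Z $$ (i, k))"
        using that by (simp add: entry sum.distrib sum_distrib_left)
      then have "c * (\<Sum>i<m. Y $$ (i, k)) + (1 - c) * (\<Sum>i<m. Z $$ (i, k)) = 1"
        using that by (simp add: B_mat_column_sum)
      from convex_combination_eq_1D[OF c _ _ this] Y'(4) Z'(4) that
      show "(\<Sum>i<m. Y $$ (i, k)) = 1" "(\<Sum>i<m. Z $$ (i, k)) = 1"
        by auto
    qed
    \<comment> \<open>The collected conditions determine a single matrix, so \<open>Y\<close> and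
      \<open>Z\<close> agree because each equals B.\<close>
    have "Y = B_mat m \<alpha>"
      by (intro eq_B_mat_if_sum_eq assms(1) Y zero(1) row(1) col(1))
    moreover have "Z = B_mat m \<alpha>"
      by (intro eq_B_mat_if_sum_eq assms(1) Z zero(2) row(2) col(2))
    ultimately show ?thesis
      by simp
  qed
  then show ?thesis
    using B_mat_in_doubly_substochastic_sum[OF assms] unfolding extreme_point_mat_def by blast
qed

end
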